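(* Let $\Delta x,\Delta t>0$ and $\alpha,\beta\in\mathbb{R}$. Consider the scheme $\mathrm{CS}(\alpha,\beta)$, namely $\widetilde{\mathcal A}=0$, for the nonlinear heat equation $\mathcal A\equiv u_t-u_x^2-uu_{xx}=0$, where $$\widetilde{\mathcal A}=D_m\widetilde{F_1}+D_n\widetilde{G_1},\qquad \widetilde{F_1}=D_m\left(\widetilde{f[u]}\right),\qquad \widetilde{f[u]}=-\tfrac12u_{-1,0}u_{-1,1}+\Delta t^2\beta\,(D_nu_{-1,0})^2,$$ $$\widetilde{G_1}=u_{0,0}+\alpha\,\Delta x^2D_m^2u_{-1,0}.$$ (i) The scheme preserves the discrete conservation law $\widetilde{\mathcal A}=D_m\widetilde{F_1}+D_n\widetilde{G_1}=0$, with characteristic $\widetilde{\mathcal Q_1}=1$, and also a second one with characteristic $\widetilde{\mathcal Q_2}=x_0$: identically in the grid function $u$, $$x_0\,\widetilde{\mathcal A}=D_m\widetilde{F_2}+D_n\widetilde{G_2},\qquad \widetilde{F_2}=\mu_m(x_{-1})\,\widetilde{F_1}-\mu_m\left(\widetilde{f[u]}\right),\qquad \widetilde{G_2}=x_0\,\widetilde{G_1}.$$ (ii) For fixed $\alpha,\beta$, $\widetilde{\mathcal A}$ is a second-order accurate approximation of $\mathcal A=u_t-u_x^2-uu_{xx}$ at the centre $(x_0,t_0+\Delta t/2)$ of the stencil; that is, when $u_{i,j}=u(x_i,t_j)$ for a smooth function $u$, the difference $\widetilde{\mathcal A}-\mathcal A$ at that point is $\mathcal O(\Delta x^2)+\mathcal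 O(\Delta t^2)$.
   Context: Discrete setting: a uniform grid with stepsizes $\Delta x,\Delta t$. Relative to a generic lattice point $(m,n)\in\mathbb{Z}^2$, the grid points are $x_i=x(m+i)=x(m)+i\Delta x$, $t_j=t(n+j)=t(n)+j\Delta t$, and $u_{i,j}$ denotes the value of the grid function at $(x_i,t_j)$. The forward shifts are $S_m:(x_i,t_j,u_{i,j})\mapsto(x_{i+1},t_j,u_{i+1,j})$ and $S_n:(x_i,t_j,u_{i,j})\mapsto(x_i,t_{j+1},u_{i,j+1})$, extended to functions of these quantities. With $I$ the identity, $$D_m=\tfrac1{\Delta x}(S_m-I),\quad \mu_m=\tfrac12(S_m+I),\quad D_n=\tfrac1{\Delta t}(S_n-I);$$ these operators commute. In particular $\mu_m(x_{-1})=\frac12(x_{-1}+x_0)$. A scheme $\widetilde{\mathcal A}=0$ preserves a discrete conservation law with characteristic $\widetilde{\mathcal Q}$ if $\widetilde{\mathcal Q}\widetilde{\mathcal A}=D_m(\widetilde F)+D_n(\widetilde G)$ identically, for some functions $\widetilde F,\widetilde G$ of the lattice point and finitely many shifts of $u_{0,0}$. The continuous equation has the conservation laws $\mathcal A=D_t(u)+D_x(-uu_x)$ and $x\mathcal A=D_t(xu)+D_x(u^2/2-xuu_x)$, with characteristics $1$ and $x$. *)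

theory Defs
  imports "HOL-Analysis.Analysis" "HOL-Library.Landau_Symbols"
begin

(* A discrete expression E is a function of the base point x_0, t_0 of the stencil and of the
   values u i j = u_{i,j} of the grid function relative to that base point.  The indices i, j may
   be negative, and x_i, t_j are recovered from the base point and the stepsizes. *)
type_synonym dexpr = "real \<Rightarrow> real \<Rightarrow> (int \<Rightarrow> int \<Rightarrow> real) \<Rightarrow> real"

definition uval :: "int \<Rightarrow> int \<Rightarrow> dexpr" where
  "uval i j = (\<lambda>x t u. u i j)"

definition xval :: "real \<Rightarrow> int \<Rightarrow> dexpr" where
  "xval \<Delta>x i = (\<lambda>x t u. x + of_int i * \<Delta>x)"

definition Sm :: "real \<Rightarrow> dexpr \<Rightarrow> dexpr" where
  "Sm \<Delta>x E = (\<lambda>x t u. E (x + \<Delta>x) t (\<lambda>i j. u (i + 1) j))"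

definition Sn :: "real \<Rightarrow> dexpr \<Rightarrow> dexpr" where
  "Sn \<Delta>t E = (\<lambda>x t u. E x (t + \<Delta>t) (\<lambda>i j. u i (j + 1)))"

definition Dm :: "real \<Rightarrow> dexpr \<Rightarrow> dexpr" where
  "Dm \<Delta>x E = (\<lambda>x t u. (Sm \<Delta>x E x t u - E x t u) / \<Delta>x)"

definition Dn :: "real \<Rightarrow> dexpr \<Rightarrow> dexpr" where
  "Dn \<Delta>t E = (\<lambda>x t u. (Sn \<Delta>t E x t u - E x t u) / \<Delta>t)"

definition mum :: "real \<Rightarrow> dexpr \<Rightarrow> dexpr" where
  "mum \<Delta>x E = (\<lambda>x t u. (Sm \<Delta>x E x t u + E x t u) / 2)"

(* Only finitely many shifts of u_{0,0} occur, the same ones at every lattice point.  Without this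
   requirement every equation would be a conservation law. *)
definition finite_stencil :: "dexpr \<Rightarrow> bool" where
  "finite_stencil E \<longleftrightarrow> (\<exists>J. finite J \<and>
     (\<forall>x t u v. (\<forall>(i, j)\<in>J. u i j = v i j) \<longrightarrow> E x t u = E x t v))"

(* The scheme A = 0 preserves the conservation law D_m F + D_n G = 0 with characteristic Q. *)
definition preserves_conservation_law ::
  "real \<Rightarrow> real \<Rightarrow> dexpr \<Rightarrow> dexpr \<Rightarrow> dexpr \<Rightarrow> dexpr \<Rightarrow> bool" where
  "preserves_conservation_law \<Delta>x \<Delta>t A Q F G \<longleftrightarrow>
     finite_stencil A \<and> finite_stencil Q \<and> finite_stencil F \<and> finite_stencil G \<and>
     (\<forall>x t u. Q x t u * A x t u = Dm \<Delta>x F x t u + Dn \<Delta>t G x t u)"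

definition flux_f :: "real \<Rightarrow> real \<Rightarrow> dexpr" where
  "flux_f \<beta> \<Delta>t = (\<lambda>x t u. - (1 / 2) * uval (-1) 0 x t u * uval (-1) 1 x t u
      + \<Delta>t^2 * \<beta> * (Dn \<Delta>t (uval (-1) 0) x t u)^2)"

definition F1 :: "real \<Rightarrow> real \<Rightarrow> real \<Rightarrow> dexpr" where
  "F1 \<beta> \<Delta>x \<Delta>t = Dm \<Delta>x (flux_f \<beta> \<Delta>t)"

definition G1 :: "real \<Rightarrow> real \<Rightarrow> dexpr" where
  "G1 \<alpha> \<Delta>x = (\<lambda>x t u. uval 0 0 x t u + \<alpha> * \<Delta>x^2 * Dm \<Delta>x (Dm \<Delta>x (uval (-1) 0)) x t u)"

definition CS :: "real \<Rightarrow> real \<Rightarrow> real \<Rightarrow> real \<Rightarrow> dexpr" where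
  "CS \<alpha> \<beta> \<Delta>x \<Delta>t = (\<lambda>x t u. Dm \<Delta>x (F1 \<beta> \<Delta>x \<Delta>t) x t u + Dn \<Delta>t (G1 \<alpha> \<Delta>x) x t u)"

definition F2 :: "real \<Rightarrow> real \<Rightarrow> real \<Rightarrow> dexpr" where
  "F2 \<beta> \<Delta>x \<Delta>t = (\<lambda>x t u. mum \<Delta>x (xval \<Delta>x (-1)) x t u * F1 \<beta> \<Delta>x \<Delta>t x t u
      - mum \<Delta>x (flux_f \<beta> \<Delta>t) x t u)"

definition G2 :: "real \<Rightarrow> real \<Rightarrow> dexpr" where
  "G2 \<alpha> \<Delta>x = (\<lambda>x t u. xval \<Delta>x 0 x t u * G1 \<alpha> \<Delta>x x t u)"

(* k-fold differentiability on an open set S with continuous k-th derivatives *)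
primrec k_smooth_on ::
  "nat \<Rightarrow> 'a::real_normed_vector set \<Rightarrow> ('a \<Rightarrow> 'b::real_normed_vector) \<Rightarrow> bool" where
  "k_smooth_on 0 S f \<longleftrightarrow> continuous_on S f"
| "k_smooth_on (Suc k) S f \<longleftrightarrow> (\<forall>p\<in>S. f differentiable (at p)) \<and>
     (\<forall>v. k_smooth_on k S (\<lambda>p. frechet_derivative f (at p) v))"

definition smooth_on :: "'a::real_normed_vector set \<Rightarrow> ('a \<Rightarrow> 'b::real_normed_vector) \<Rightarrow> bool" where
  "smooth_on S f \<longleftrightarrow> (\<forall>k. k_smooth_on k S f)"

definition heat :: "(real \<times> real \<Rightarrow> real) \<Rightarrow> real \<Rightarrow> real \<Rightarrow> real" where
  "heat u x t = deriv (\<lambda>s. u (x, s)) t - (deriv (\<lambda>y. u (y, t)) x)^2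
      - u (x, t) * (deriv ^^ 2) (\<lambda>y. u (y, t)) x"

definition sample ::
  "(real \<times> real \<Rightarrow> real) \<Rightarrow> real \<Rightarrow> real \<Rightarrow> real \<Rightarrow> real \<Rightarrow> int \<Rightarrow> int \<Rightarrow> real" where
  "sample u \<Delta>x \<Delta>t x\<^sub>0 t\<^sub>0 = (\<lambda>i j. u (x\<^sub>0 + of_int i * \<Delta>x, t\<^sub>0 + of_int j * \<Delta>t))"

end

theory Submission
  imports Defs
begin

text \<open>
  Both conservation laws are algebraic identities.  For consistency, write
  \<open>a = u(\<cdot>, t\<^sub>0)\<close> and \<open>b = u(\<cdot>, t\<^sub>0 + \<Delta>t)\<close>.  The flux term of the scheme is the centred second
  difference in \<open>x\<close> of \<open>- a b / 2 + \<beta> (b - a)\<^sup>2\<close>, hence its second derivative up to \<open>O(\<Delta>x\<^sup>2)\<close>;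
  the \<open>\<alpha>\<close> term is a second difference of \<open>(b - a) / \<Delta>t\<close> without the factor \<open>1 / \<Delta>x\<^sup>2\<close>, hence
  \<open>O(\<Delta>x\<^sup>2)\<close>.  Symmetric products of values at \<open>t\<^sub>0\<close> and \<open>t\<^sub>0 + \<Delta>t\<close> agree with the product at the
  midpoint up to \<open>O(\<Delta>t\<^sup>2)\<close>.  All constants come from bounds of finitely many
  derivatives \<open>\<partial>\<^sub>t\<^sup>j \<partial>\<^sub>x\<^sup>i u\<close> on a compact box, so that no interchange of partial derivatives is needed.
\<close>

section \<open>Partial derivatives of smooth functions\<close>

text \<open>\<open>k_smooth_on\<close> recurses on exactly such directional values of the Frechet
  derivative, so smoothness passes to \<open>partial_x\<close> and \<open>partial_t\<close> at once.
  Where the function is differentiable they are the usual partial derivatives.\<close>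

definition partial_x :: "(real \<times> real \<Rightarrow> real) \<Rightarrow> real \<times> real \<Rightarrow> real" where
  "partial_x f p = frechet_derivative f (at p) (1, 0)"

definition partial_t :: "(real \<times> real \<Rightarrow> real) \<Rightarrow> real \<times> real \<Rightarrow> real" where
  "partial_t f p = frechet_derivative f (at p) (0, 1)"

lemma smooth_on_frechet_derivative:
  assumes "smooth_on S f"
  shows "smooth_on S (\<lambda>p. frechet_derivative f (at p) v)"
  using assms unfolding smooth_on_def by (metis k_smooth_on.simps(2))

lemma smooth_on_partial_x: "smooth_on S f \<Longrightarrow> smooth_on S (partial_x f)"
  unfolding partial_x_def[abs_def] by (rule smooth_on_frechet_derivative)

lemma smooth_on_partial_t: "smooth_on S f \<Longrightarrow> smooth_on S (partial_t f)"
  unfolding partial_t_def[abs_def] by (rule smooth_on_frechet_derivative)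

lemma smooth_on_iterated_partials:
  assumes "smooth_on S f"
  shows "smooth_on S ((partial_t ^^ j) ((partial_x ^^ i) f))"
proof -
  have "smooth_on S ((partial_x ^^ i) f)"
    by (induction i) (use assms in \<open>auto intro: smooth_on_partial_x\<close>)
  then show ?thesis
    by (induction j) (auto intro: smooth_on_partial_t)
qed

lemma smooth_on_imp_continuous_on: "smooth_on S f \<Longrightarrow> continuous_on S f"
  unfolding smooth_on_def by (metis k_smooth_on.simps(1))

lemma smooth_on_imp_has_derivative:
  assumes "smooth_on S f" "p \<in> S"
  shows "(f has_derivative frechet_derivative f (at p)) (at p)"
  using assms unfolding smooth_on_def by (metis k_smooth_on.simps(2) frechet_derivative_works)

text \<open>The chain rule along a curve: by linearity, \<open>f' (d *\<^sub>R v)\<close> is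
  \<open>f' v * d\<close>, so \<open>f' v\<close> is an ordinary real derivative.\<close>

lemma has_derivative_compose_line:
  fixes f :: "'a::real_normed_vector \<Rightarrow> real"
  assumes "(f has_derivative f') (at (g s))" "(g has_vector_derivative v) (at s)"
  shows "((\<lambda>s. f (g s)) has_real_derivative f' v) (at s)"
proof -
  have "((\<lambda>s. f (g s)) has_derivative (\<lambda>d. f' (d *\<^sub>R v))) (at s)"
    using has_derivative_compose[OF assms(2)[unfolded has_vector_derivative_def] assms(1)] .
  moreover have "(\<lambda>d. f' (d *\<^sub>R v)) = (\<lambda>d. f' v * d)"
    using linear_scale[OF has_derivative_linear[OF assms(1)]] by (auto simp: mult.commute)
  ultimately show ?thesis
    by (simp add: has_field_derivative_def)
qed

lemma has_real_derivative_partial_x: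
  assumes "smooth_on S f" "(x, t) \<in> S"
  shows "((\<lambda>y. f (y, t)) has_real_derivative partial_x f (x, t)) (at x)"
  unfolding partial_x_def
  by (rule has_derivative_compose_line[where g = "\<lambda>y. (y, t)"])
    (auto intro!: smooth_on_imp_has_derivative assms derivative_eq_intros
      simp: has_vector_derivative_def)

lemma has_real_derivative_partial_t:
  assumes "smooth_on S f" "(x, t) \<in> S"
  shows "((\<lambda>s. f (x, s)) has_real_derivative partial_t f (x, t)) (at t)"
  unfolding partial_t_def
  by (rule has_derivative_compose_line[where g = "\<lambda>s. (x, s)"])
    (auto intro!: smooth_on_imp_has_derivative assms derivative_eq_intros
      simp: has_vector_derivative_def)

text \<open>\<open>heat\<close> iterates the one-variable \<open>deriv\<close>. To differentiate a
  second time, the first derivative must equal \<open>partial_x u\<close> on a whole neighbourhood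
  of \<open>x\<close>, and openness of \<open>S\<close> supplies one on the slice.\<close>

lemma heat_eq_partials:
  assumes "open S" "smooth_on S u" "(x, t) \<in> S"
  shows "heat u x t = partial_t u (x, t) - (partial_x u (x, t))\<^sup>2
    - u (x, t) * partial_x (partial_x u) (x, t)"
proof -
  have d: "deriv (\<lambda>y. u (y, t)) y = partial_x u (y, t)" if "(y, t) \<in> S" for y
    using has_real_derivative_partial_x[OF assms(2) that] by (rule DERIV_imp_deriv)
  have "open ((\<lambda>y. (y, t)) -` S)"
    using assms(1) by (intro open_vimage) (auto intro!: continuous_intros)
  then have "\<forall>\<^sub>F y in nhds x. y \<in> (\<lambda>y. (y, t)) -` S"
    using assms(3) by (intro eventually_nhds_in_open) auto
  then have "\<forall>\<^sub>F y in nhds x. deriv (\<lambda>y. u (y, t)) y = partial_x u (y, t)"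
    by eventually_elim (auto intro: d)
  then have "deriv (deriv (\<lambda>y. u (y, t))) x = deriv (\<lambda>y. partial_x u (y, t)) x"
    by (intro deriv_cong_ev) auto
  also have "\<dots> = partial_x (partial_x u) (x, t)"
    using assms by (intro DERIV_imp_deriv has_real_derivative_partial_x[where S = S])
      (auto intro: smooth_on_partial_x)
  finally show ?thesis
    using d[OF assms(3)] DERIV_imp_deriv[OF has_real_derivative_partial_t[OF assms(2,3)]]
    by (simp add: heat_def numeral_2_eq_2)
qed

text \<open>Finitely many continuous images of a compact set have a bounded union, so a single
  constant serves all orders.\<close>

lemma iterated_partials_bounded:
  assumes "smooth_on S u" "compact K" "K \<subseteq> S"
  obtains M where "0 \<le> M"
    "\<And>i j p. i \<le> m \<Longrightarrow> j \<le> n \<Longrightarrow> p \<in> K \<Longrightarrow>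
      \<bar>(partial_t ^^ j) ((partial_x ^^ i) u) p\<bar> \<le> M"
proof -
  have "bounded (\<Union>i\<le>m. \<Union>j\<le>n. (partial_t ^^ j) ((partial_x ^^ i) u) ` K)"
    using assms
    by (intro bounded_UN finite_atMost ballI compact_imp_bounded compact_continuous_image
        smooth_on_imp_continuous_on[THEN continuous_on_subset] smooth_on_iterated_partials)
  then obtain M where "\<forall>y\<in>(\<Union>i\<le>m. \<Union>j\<le>n. (partial_t ^^ j) ((partial_x ^^ i) u) ` K). \<bar>y\<bar> \<le> M"
    unfolding bounded_real by blast
  then show thesis
    by (intro that[of "max 0 M"]) (auto intro: le_max_iff_disj[THEN iffD2])
qed

section \<open>Taylor estimates for finite differences\<close>

text \<open>Lagrange's form of the remainder. Distances are measured by
  \<open>\<bar>h\<bar>\<close>, so that the increments \<open>h\<close> and \<open>- h\<close> can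
  share the same hypotheses.\<close>

lemma Taylor_bound:
  fixes diff :: "nat \<Rightarrow> real \<Rightarrow> real"
  assumes "0 < n"
    and deriv: "\<And>m s. m < n \<Longrightarrow> \<bar>s - c\<bar> \<le> \<bar>h\<bar> \<Longrightarrow>
      (diff m has_real_derivative diff (Suc m) s) (at s)"
    and bound: "\<And>s. \<bar>s - c\<bar> \<le> \<bar>h\<bar> \<Longrightarrow> \<bar>diff n s\<bar> \<le> M"
  shows "\<bar>diff 0 (c + h) - (\<Sum>m<n. diff m c / fact m * h ^ m)\<bar> \<le> M / fact n * \<bar>h\<bar> ^ n"
proof (cases "h = 0")
  \<comment> \<open>Only the term \<open>m = 0\<close> of the polynomial survives and the right-hand
    side vanishes; \<open>Taylor\<close> itself requires a nonzero increment.\<close>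
  case True
  with \<open>0 < n\<close> show ?thesis
    by (cases n) (simp_all add: power_0_left sum.lessThan_Suc_shift del: sum.lessThan_Suc)
next
  case False
  obtain s where s: "if c + h < c then c + h < s \<and> s < c else c < s \<and> s < c + h"
    and eq: "diff 0 (c + h) =
      (\<Sum>m<n. diff m c / fact m * (c + h - c) ^ m) + diff n s / fact n * (c + h - c) ^ n"
  proof (atomize_elim, rule Taylor)
    show "\<forall>m s. m < n \<and> c - \<bar>h\<bar> \<le> s \<and> s \<le> c + \<bar>h\<bar> \<longrightarrow>
        (diff m has_real_derivative diff (Suc m) s) (at s)"
      using deriv by (simp add: abs_le_iff)
  qed (use \<open>0 < n\<close> False in auto)
  have "\<bar>diff n s\<bar> \<le> M"
    using s by (intro bound) (auto split: if_splits)
  then have "\<bar>diff n s / fact n * h ^ n\<bar> \<le> M / fact n * \<bar>h\<bar> ^ n"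
    by (simp add: abs_mult power_abs divide_right_mono mult_right_mono)
  with eq show ?thesis by simp
qed

text \<open>In the expansions at \<open>h\<close> and \<open>- h\<close> the linear terms cancel,
  leaving two remainders of size M h^2 / 2.\<close>

lemma second_difference_bound:
  fixes f f' f'' :: "real \<Rightarrow> real"
  assumes "\<And>s. \<bar>s - c\<bar> \<le> \<bar>h\<bar> \<Longrightarrow> (f has_real_derivative f' s) (at s)"
    and "\<And>s. \<bar>s - c\<bar> \<le> \<bar>h\<bar> \<Longrightarrow> (f' has_real_derivative f'' s) (at s)"
    and "\<And>s. \<bar>s - c\<bar> \<le> \<bar>h\<bar> \<Longrightarrow> \<bar>f'' s\<bar> \<le> M"
  shows "\<bar>f (c + h) - 2 * f c + f (c - h)\<bar> \<le> M * h\<^sup>2"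
proof -
  define D where "D m = [f, f', f''] ! m" for m
  define T where "T d = (\<Sum>m<2. D m c / fact m * d ^ m)" for d
  have bound: "\<bar>D 0 (c + d) - T d\<bar> \<le> M / fact 2 * \<bar>h\<bar> ^ 2" if "\<bar>d\<bar> = \<bar>h\<bar>" for d
    unfolding T_def that[symmetric]
    by (rule Taylor_bound) (use assms that in \<open>auto simp: D_def less_2_cases_iff\<close>)
  have "f (c + h) - 2 * f c + f (c - h) = (D 0 (c + h) - T h) + (D 0 (c + - h) - T (- h))"
    by (simp add: T_def D_def numeral_2_eq_2 algebra_simps)
  also have "\<bar>\<dots>\<bar> \<le> M / fact 2 * \<bar>h\<bar> ^ 2 + M / fact 2 * \<bar>h\<bar> ^ 2"
    by (intro order_trans[OF abs_triangle_ineq] add_mono bound) auto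
  finally show ?thesis
    by (simp add: power2_abs)
qed

text \<open>The even terms of the two expansions cancel; the two remainders contribute M / 6
  each.\<close>

lemma central_difference_bound:
  fixes f f' f'' f''' :: "real \<Rightarrow> real"
  assumes "\<And>s. \<bar>s - c\<bar> \<le> \<bar>h\<bar> \<Longrightarrow> (f has_real_derivative f' s) (at s)"
    and "\<And>s. \<bar>s - c\<bar> \<le> \<bar>h\<bar> \<Longrightarrow> (f' has_real_derivative f'' s) (at s)"
    and "\<And>s. \<bar>s - c\<bar> \<le> \<bar>h\<bar> \<Longrightarrow> (f'' has_real_derivative f''' s) (at s)"
    and "\<And>s. \<bar>s - c\<bar> \<le> \<bar>h\<bar> \<Longrightarrow> \<bar>f''' s\<bar> \<le> M"
  shows "\<bar>f (c + h) - f (c - h) - 2 * h * f' c\<bar> \<le> M / 3 * \<bar>h\<bar> ^ 3"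
proof -
  define D where "D m = [f, f', f'', f'''] ! m" for m
  define T where "T d = (\<Sum>m<3. D m c / fact m * d ^ m)" for d
  have bound: "\<bar>D 0 (c + d) - T d\<bar> \<le> M / fact 3 * \<bar>h\<bar> ^ 3" if "\<bar>d\<bar> = \<bar>h\<bar>" for d
    unfolding T_def that[symmetric]
    by (rule Taylor_bound) (use assms that in \<open>auto simp: D_def less_Suc_eq numeral_3_eq_3\<close>)
  have "f (c + h) - f (c - h) - 2 * h * f' c = (D 0 (c + h) - T h) - (D 0 (c + - h) - T (- h))"
    by (simp add: T_def D_def eval_nat_numeral algebra_simps)
  also have "\<bar>\<dots>\<bar> \<le> M / fact 3 * \<bar>h\<bar> ^ 3 + M / fact 3 * \<bar>h\<bar> ^ 3"
    by (intro order_trans[OF abs_triangle_ineq4] add_mono bound) auto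
  finally show ?thesis
    by (simp add: fact_numeral)
qed

text \<open>The odd terms cancel, and the fourth-order remainders contribute M / 24 each.\<close>

lemma second_difference_consistency:
  fixes D :: "nat \<Rightarrow> real \<Rightarrow> real"
  assumes "\<And>m s. m < 4 \<Longrightarrow> \<bar>s - c\<bar> \<le> \<bar>h\<bar> \<Longrightarrow> (D m has_real_derivative D (Suc m) s) (at s)"
    and "\<And>s. \<bar>s - c\<bar> \<le> \<bar>h\<bar> \<Longrightarrow> \<bar>D 4 s\<bar> \<le> M"
  shows "\<bar>D 0 (c + h) - 2 * D 0 c + D 0 (c - h) - h\<^sup>2 * D 2 c\<bar> \<le> M / 12 * h ^ 4"
proof -
  define T where "T d = (\<Sum>m<4. D m c / fact m * d ^ m)" for d
  have bound: "\<bar>D 0 (c + d) - T d\<bar> \<le> M / fact 4 * \<bar>h\<bar> ^ 4" if "\<bar>d\<bar> = \<bar>h\<bar>" for d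
    unfolding T_def that[symmetric]
    by (rule Taylor_bound) (use assms that in auto)
  have "D 0 (c + h) - 2 * D 0 c + D 0 (c - h) - h\<^sup>2 * D 2 c = (D 0 (c + h) - T h) + (D 0 (c + - h) - T (- h))"
    by (simp add: T_def eval_nat_numeral algebra_simps)
  also have "\<bar>\<dots>\<bar> \<le> M / fact 4 * \<bar>h\<bar> ^ 4 + M / fact 4 * \<bar>h\<bar> ^ 4"
    by (intro order_trans[OF abs_triangle_ineq] add_mono bound) auto
  finally show ?thesis
    by (simp add: fact_numeral)
qed

lemma Leibniz_has_real_derivative:
  fixes A B :: "nat \<Rightarrow> real \<Rightarrow> real"
  assumes "\<And>i. i \<le> m \<Longrightarrow> (A i has_real_derivative A (Suc i) s) (at s)"
    and "\<And>i. i \<le> m \<Longrightarrow> (B i has_real_derivative B (Suc i) s) (at s)"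
  shows "((\<lambda>s. \<Sum>i\<le>m. of_nat (m choose i) * A i s * B (m - i) s) has_real_derivative
    (\<Sum>i\<le>Suc m. of_nat (Suc m choose i) * A i s * B (Suc m - i) s)) (at s)"
proof -
  have "((\<lambda>s. \<Sum>i\<le>m. of_nat (m choose i) * A i s * B (m - i) s) has_real_derivative
    (\<Sum>i\<le>m. of_nat (m choose i) * (A (Suc i) s * B (m - i) s + A i s * B (Suc m - i) s))) (at s)"
    by (rule DERIV_sum) (auto intro!: derivative_eq_intros assms simp: algebra_simps Suc_diff_le)
  moreover have "(\<Sum>i\<le>Suc m. of_nat (Suc m choose i) * A i s * B (Suc m - i) s) =
    (\<Sum>i\<le>m. of_nat (m choose i) * (A (Suc i) s * B (m - i) s + A i s * B (Suc m - i) s))"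
  proof -
    \<comment> \<open>The index is shifted by splitting off \<open>i = 0\<close>; the extra top term
      has the coefficient \<open>m choose Suc m\<close>, which is zero. Pascal's rule then merges
      the two sums.\<close>
    have "(\<Sum>i\<le>m. of_nat (m choose i) * (A i s * B (Suc m - i) s)) =
      A 0 s * B (Suc m) s + (\<Sum>i\<le>m. of_nat (m choose Suc i) * (A (Suc i) s * B (m - i) s))"
      using sum.atMost_Suc_shift[of "\<lambda>i. of_nat (m choose i) * (A i s * B (Suc m - i) s)" m]
      by (simp add: binomial_eq_0)
    then show ?thesis
      unfolding sum.atMost_Suc_shift
      by (simp add: algebra_simps sum.distrib)
  qed
  ultimately show ?thesis by simp
qed

lemma second_difference_mult:
  fixes A B :: "nat \<Rightarrow> real \<Rightarrow> real"
  assumes dA: "\<And>m s. m < 4 \<Longrightarrow> \<bar>s - c\<bar> \<le> \<bar>h\<bar> \<Longrightarrow> (A m has_real_derivative A (Suc m) s) (at s)"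
    and dB: "\<And>m s. m < 4 \<Longrightarrow> \<bar>s - c\<bar> \<le> \<bar>h\<bar> \<Longrightarrow> (B m has_real_derivative B (Suc m) s) (at s)"
    and bA: "\<And>m s. m \<le> 4 \<Longrightarrow> \<bar>s - c\<bar> \<le> \<bar>h\<bar> \<Longrightarrow> \<bar>A m s\<bar> \<le> P"
    and bB: "\<And>m s. m \<le> 4 \<Longrightarrow> \<bar>s - c\<bar> \<le> \<bar>h\<bar> \<Longrightarrow> \<bar>B m s\<bar> \<le> Q"
  shows "\<bar>A 0 (c + h) * B 0 (c + h) - 2 * (A 0 c * B 0 c) + A 0 (c - h) * B 0 (c - h)
      - h\<^sup>2 * (A 2 c * B 0 c + 2 * A 1 c * B 1 c + A 0 c * B 2 c)\<bar> \<le> 4 / 3 * (P * Q) * h ^ 4"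
proof -
  \<comment> \<open>By the Leibniz rule \<open>D m\<close> is the m-th derivative of the product.
    The binomial coefficients of order 4 add up to 16, whence 16 / 12 = 4 / 3.\<close>
  define D where "D m s = (\<Sum>i\<le>m. of_nat (m choose i) * A i s * B (m - i) s)" for m s
  have "\<bar>D 0 (c + h) - 2 * D 0 c + D 0 (c - h) - h\<^sup>2 * D 2 c\<bar> \<le> 16 * (P * Q) / 12 * h ^ 4"
  proof (rule second_difference_consistency)
    fix m s assume "m < (4::nat)" "\<bar>s - c\<bar> \<le> \<bar>h\<bar>"
    then show "(D m has_real_derivative D (Suc m) s) (at s)"
      unfolding D_def[abs_def] by (intro Leibniz_has_real_derivative dA dB) auto
  next
    fix s assume s: "\<bar>s - c\<bar> \<le> \<bar>h\<bar>"
    have "0 \<le> P"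
      using bA[of 0 s] s by auto
    have "\<bar>D 4 s\<bar> \<le> (\<Sum>i\<le>4. \<bar>of_nat (4 choose i) * A i s * B (4 - i) s\<bar>)"
      unfolding D_def by (rule sum_abs)
    also have "\<dots> \<le> (\<Sum>i\<le>4. of_nat (4 choose i) * (P * Q))"
      using \<open>0 \<le> P\<close> s
      by (intro sum_mono) (auto simp: abs_mult mult.assoc intro!: mult_left_mono mult_mono bA bB)
    also have "\<dots> = 16 * (P * Q)"
      by (simp add: eval_nat_numeral algebra_simps)
    finally show "\<bar>D 4 s\<bar> \<le> 16 * (P * Q)" .
  qed
  then show ?thesis
    by (simp add: D_def numeral_2_eq_2 algebra_simps)
qed

text \<open>With \<open>a = m - d\<close> and \<open>b = m + d\<close> the symmetrised product is the product of the averages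
  minus the product of the half differences.\<close>
lemma symmetrised_product_bound:
  fixes a b m a' b' m' :: real
  assumes "\<bar>a\<bar> \<le> M" "\<bar>b\<bar> \<le> M" "\<bar>m'\<bar> \<le> M"
    and "\<bar>(a + b) / 2 - m\<bar> \<le> M * e" "\<bar>(a' + b') / 2 - m'\<bar> \<le> M * e"
    and "\<bar>b - a\<bar> \<le> M * k" "\<bar>b' - a'\<bar> \<le> M * k"
  shows "\<bar>(a * b' + b * a') / 2 - m * m'\<bar> \<le> 2 * M\<^sup>2 * e + M\<^sup>2 * k\<^sup>2 / 4"
proof -
  \<comment> \<open>The terms \<open>p\<close> and \<open>q\<close> pass from the product of the
    averages to \<open>m * m'\<close> one factor at a time; \<open>d / 4\<close> is the product of
    the half differences.\<close>
  define p q d where "p = (a + b) / 2 * ((a' + b') / 2 - m')"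
    and "q = ((a + b) / 2 - m) * m'" and "d = (b - a) * (b' - a')"
  have "(a * b' + b * a') / 2 - m * m' = p + q - d / 4"
    by (simp add: p_def q_def d_def field_simps)
  moreover have "\<bar>p\<bar> \<le> M * (M * e)"
    unfolding p_def abs_mult by (rule mult_mono) (use assms in auto)
  moreover have "\<bar>q\<bar> \<le> (M * e) * M"
    unfolding q_def abs_mult by (rule mult_mono) (use assms in auto)
  moreover have "\<bar>d\<bar> \<le> (M * k) * (M * k)"
    unfolding d_def abs_mult by (rule mult_mono) (use assms in auto)
  ultimately show ?thesis
    by (simp add: power2_eq_square ac_simps)
qed

section \<open>Accuracy of the scheme\<close>

text \<open>The factor \<open>\<Delta>t^2\<close> of the \<beta> term cancels the denominator of the
  squared time difference. Squares are written as products so that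
  \<open>second_difference_mult\<close> applies.\<close>

lemma CS_sample_eq:
  fixes u :: "real \<times> real \<Rightarrow> real" and t\<^sub>0 :: real
  assumes "\<Delta>x \<noteq> 0" "\<Delta>t \<noteq> 0"
  defines "a \<equiv> \<lambda>y. u (y, t\<^sub>0)" and "b \<equiv> \<lambda>y. u (y, t\<^sub>0 + \<Delta>t)"
  shows "CS \<alpha> \<beta> \<Delta>x \<Delta>t x\<^sub>0 t\<^sub>0 (sample u \<Delta>x \<Delta>t x\<^sub>0 t\<^sub>0) =
    - (1 / 2) * ((a (x\<^sub>0 + \<Delta>x) * b (x\<^sub>0 + \<Delta>x) - 2 * (a x\<^sub>0 * b x\<^sub>0)
        + a (x\<^sub>0 - \<Delta>x) * b (x\<^sub>0 - \<Delta>x)) / \<Delta>x\<^sup>2)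
    + \<beta> * (((b (x\<^sub>0 + \<Delta>x) - a (x\<^sub>0 + \<Delta>x)) * (b (x\<^sub>0 + \<Delta>x) - a (x\<^sub>0 + \<Delta>x))
        - 2 * ((b x\<^sub>0 - a x\<^sub>0) * (b x\<^sub>0 - a x\<^sub>0))
        + (b (x\<^sub>0 - \<Delta>x) - a (x\<^sub>0 - \<Delta>x)) * (b (x\<^sub>0 - \<Delta>x) - a (x\<^sub>0 - \<Delta>x))) / \<Delta>x\<^sup>2)
    + (b x\<^sub>0 - a x\<^sub>0) / \<Delta>t
    + \<alpha> * (((b (x\<^sub>0 + \<Delta>x) - a (x\<^sub>0 + \<Delta>x)) - 2 * (b x\<^sub>0 - a x\<^sub>0)
        + (b (x\<^sub>0 - \<Delta>x) - a (x\<^sub>0 - \<Delta>x))) / \<Delta>t)"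
  using assms(1,2) unfolding a_def b_def
  by (simp add: CS_def F1_def G1_def flux_f_def Dm_def Dn_def Sm_def Sn_def uval_def sample_def
      power2_eq_square) (simp add: field_simps)

lemma CS_error_bound:
  assumes "open \<Omega>" "(x\<^sub>0, t\<^sub>0) \<in> \<Omega>" and u: "smooth_on \<Omega> u"
  obtains r C where "0 < r"
    "\<And>h k. 0 < h \<Longrightarrow> h < r \<Longrightarrow> 0 < k \<Longrightarrow> k < r \<Longrightarrow>
      \<bar>CS \<alpha> \<beta> h k x\<^sub>0 t\<^sub>0 (sample u h k x\<^sub>0 t\<^sub>0) - heat u x\<^sub>0 (t\<^sub>0 + k / 2)\<bar> \<le> C * (h\<^sup>2 + k\<^sup>2)"
proof -
  obtain A B where AB: "open A" "open B" "x\<^sub>0 \<in> A" "t\<^sub>0 \<in> B" "A \<times> B \<subseteq> \<Omega>"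
    using open_prod_elim[OF assms(1,2)] by (metis mem_Sigma_iff)
  obtain r1 r2 where r12: "r1 > 0" "cball x\<^sub>0 r1 \<subseteq> A" "r2 > 0" "cball t\<^sub>0 r2 \<subseteq> B"
    using AB(1-4) unfolding open_contains_cball by meson
  define r where "r = min r1 r2"
  define K where "K = cball x\<^sub>0 r \<times> cball t\<^sub>0 r"
  have "r > 0" and K: "K \<subseteq> \<Omega>" "compact K"
    using r12 AB(5) unfolding K_def r_def by (force, force, intro compact_Times) auto
  have inK: "(y, s) \<in> K \<longleftrightarrow> \<bar>y - x\<^sub>0\<bar> \<le> r \<and> \<bar>s - t\<^sub>0\<bar> \<le> r" for y s
    by (auto simp: K_def dist_real_def abs_minus_commute)
  define w where "w j i = (partial_t ^^ j) ((partial_x ^^ i) u)" for j i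
  have smooth: "smooth_on \<Omega> (w j i)" for i j
    unfolding w_def by (rule smooth_on_iterated_partials[OF u])
  obtain M where "0 \<le> M"
    \<comment> \<open>Four derivatives in x serve the consistency of the second difference, three in
      t the central difference.\<close>
    and M: "\<And>i j p. i \<le> 4 \<Longrightarrow> j \<le> 3 \<Longrightarrow> p \<in> K \<Longrightarrow> \<bar>w j i p\<bar> \<le> M"
    using iterated_partials_bounded[OF u K(2,1)] unfolding w_def by metis
  \<comment> \<open>In \<open>w\<close> the time derivatives are applied last, so the x-derivative
    is read off only for \<open>j = 0\<close>, whereas \<open>wt\<close> holds for all
    \<open>j\<close> and \<open>i\<close>.\<close>
  have wx: "((\<lambda>y. w 0 i (y, s)) has_real_derivative w 0 (Suc i) (y, s)) (at y)"
    if "(y, s) \<in> K" for i y s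
    using has_real_derivative_partial_x[OF smooth[of 0 i]] that K(1) by (auto simp: w_def)
  have wt: "((\<lambda>s. w j i (y, s)) has_real_derivative w (Suc j) i (y, s)) (at s)"
    if "(y, s) \<in> K" for i j y s
    using has_real_derivative_partial_t[OF smooth[of j i]] that K(1) by (auto simp: w_def)
  \<comment> \<open>\<open>C1\<close> and \<open>C2\<close> collect the coefficients of h^2 and k^2.
    Differences \<open>c\<close> are bounded by \<open>2 * M\<close>, which turns 4 / 3 into 16 / 3
    in the \<beta> term.\<close>
  define C1 where "C1 = 2 / 3 * M\<^sup>2 + \<bar>\<beta>\<bar> * (16 / 3 * M\<^sup>2) + \<bar>\<alpha>\<bar> * M"
  define C2 where "C2 = M\<^sup>2 + \<bar>\<beta>\<bar> * (4 * M\<^sup>2) + M"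
  define C where "C = C1 + C2"
  have "0 \<le> C1" "0 \<le> C2"
    using \<open>0 \<le> M\<close> by (simp_all add: C1_def C2_def)
  show thesis
  proof (rule that[OF \<open>r > 0\<close>])
    fix h k :: real
    assume hk: "0 < h" "h < r" "0 < k" "k < r"
    define a b m where "a i y = w 0 i (y, t\<^sub>0)" and "b i y = w 0 i (y, t\<^sub>0 + k)"
      and "m i = w 0 i (x\<^sub>0, t\<^sub>0 + k / 2)" for i y
    define c where "c i y = b i y - a i y" for i y
    have near: "(y, t\<^sub>0) \<in> K" "(y, t\<^sub>0 + k) \<in> K" if "\<bar>y - x\<^sub>0\<bar> \<le> \<bar>h\<bar>" for y
      using that hk by (auto simp: inK)
    have near_mid: "(y, s) \<in> K" if "\<bar>y - x\<^sub>0\<bar> \<le> \<bar>h\<bar>" "\<bar>s - (t\<^sub>0 + k / 2)\<bar> \<le> \<bar>k / 2\<bar>" for y s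
      using that hk unfolding inK by linarith
    have da: "(a i has_real_derivative a (Suc i) y) (at y)" if "\<bar>y - x\<^sub>0\<bar> \<le> \<bar>h\<bar>" for i y
      unfolding a_def[abs_def] by (rule wx[OF near(1)[OF that]])
    have db: "(b i has_real_derivative b (Suc i) y) (at y)" if "\<bar>y - x\<^sub>0\<bar> \<le> \<bar>h\<bar>" for i y
      unfolding b_def[abs_def] by (rule wx[OF near(2)[OF that]])
    have dc: "(c i has_real_derivative c (Suc i) y) (at y)" if "\<bar>y - x\<^sub>0\<bar> \<le> \<bar>h\<bar>" for i y
      unfolding c_def[abs_def] using that by (intro DERIV_diff da db)
    have Ma: "\<bar>a i y\<bar> \<le> M" if "i \<le> 4" "\<bar>y - x\<^sub>0\<bar> \<le> \<bar>h\<bar>" for i y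
      unfolding a_def using that near by (intro M) auto
    have Mb: "\<bar>b i y\<bar> \<le> M" if "i \<le> 4" "\<bar>y - x\<^sub>0\<bar> \<le> \<bar>h\<bar>" for i y
      unfolding b_def using that near by (intro M) auto
    have Mc: "\<bar>c i y\<bar> \<le> 2 * M" if "i \<le> 4" "\<bar>y - x\<^sub>0\<bar> \<le> \<bar>h\<bar>" for i y
      unfolding c_def using Ma[OF that] Mb[OF that] by linarith
    have Mm: "\<bar>m i\<bar> \<le> M" if "i \<le> 4" for i
      unfolding m_def using that by (intro M near_mid) auto
    \<comment> \<open>The mean value theorem in t gains the factor \<open>k\<close> that the cruder
      bound \<open>Mc\<close> lacks.\<close>
    have Mck: "\<bar>c i y\<bar> \<le> M * k" if "i \<le> 4" "\<bar>y - x\<^sub>0\<bar> \<le> \<bar>h\<bar>" for i y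
    proof -
      have "(y, s) \<in> K" if "t\<^sub>0 \<le> s" "s \<le> t\<^sub>0 + k" for s
        using that \<open>\<bar>y - x\<^sub>0\<bar> \<le> \<bar>h\<bar>\<close> by (intro near_mid) (auto simp: abs_le_iff field_simps)
      then obtain z where "t\<^sub>0 < z" "z < t\<^sub>0 + k" "c i y = k * w 1 i (y, z)" "(y, z) \<in> K"
        using MVT2[of t\<^sub>0 "t\<^sub>0 + k" "\<lambda>s. w 0 i (y, s)" "\<lambda>s. w 1 i (y, s)"] wt[of y _ 0 i] hk(3)
        by (auto simp: c_def a_def b_def)
      moreover have "\<bar>w 1 i (y, z)\<bar> \<le> M"
        using that \<open>(y, z) \<in> K\<close> by (intro M) auto
      ultimately show ?thesis
        using hk(3) by (simp add: abs_mult mult.commute mult_right_mono)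
    qed
    \<comment> \<open>A second difference in time about the midpoint with step \<open>k / 2\<close>;
      halving M (k / 2)^2 gives the constant 1 / 8.\<close>
    have avg: "\<bar>(a i x\<^sub>0 + b i x\<^sub>0) / 2 - m i\<bar> \<le> M * (k\<^sup>2 / 8)" if "i \<le> 4" for i
    proof -
      have "\<bar>w 0 i (x\<^sub>0, t\<^sub>0 + k / 2 + k / 2) - 2 * w 0 i (x\<^sub>0, t\<^sub>0 + k / 2)
          + w 0 i (x\<^sub>0, t\<^sub>0 + k / 2 - k / 2)\<bar> \<le> M * (k / 2)\<^sup>2"
        using that
        by (intro second_difference_bound[of "t\<^sub>0 + k / 2" "k / 2" "\<lambda>s. w 0 i (x\<^sub>0, s)"
              "\<lambda>s. w 1 i (x\<^sub>0, s)" "\<lambda>s. w 2 i (x\<^sub>0, s)"])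
          (auto intro!: M wt[of _ _ 0, simplified] wt[of _ _ 1, simplified, folded numeral_2_eq_2] near_mid)
      then have "\<bar>b i x\<^sub>0 - 2 * m i + a i x\<^sub>0\<bar> \<le> M * (k / 2)\<^sup>2"
        by (simp add: a_def b_def m_def ac_simps)
      then show ?thesis
        by (simp add: power_divide abs_le_iff field_simps)
    qed
    \<comment> \<open>With e = k^2 / 8 the bound of \<open>symmetrised_product_bound\<close> is M^2
      k^2 / 4 + M^2 k^2 / 4.\<close>
    have sym: "\<bar>(a i x\<^sub>0 * b j x\<^sub>0 + b i x\<^sub>0 * a j x\<^sub>0) / 2 - m i * m j\<bar> \<le> M\<^sup>2 * k\<^sup>2 / 2"
      if "i \<le> 4" "j \<le> 4" for i j
      using symmetrised_product_bound[OF Ma[of i x\<^sub>0] Mb[of i x\<^sub>0] Mm[of j] avg[of i] avg[of j]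
          Mck[of i x\<^sub>0, unfolded c_def] Mck[of j x\<^sub>0, unfolded c_def]] that
      by simp
    have cc: "\<bar>c i x\<^sub>0 * c j x\<^sub>0\<bar> \<le> M\<^sup>2 * k\<^sup>2" if "i \<le> 4" "j \<le> 4" for i j
      using mult_mono[OF Mck[of i x\<^sub>0] Mck[of j x\<^sub>0]] that hk \<open>0 \<le> M\<close>
      by (simp add: abs_mult power2_eq_square algebra_simps)

    define Pab where "Pab = (a 0 (x\<^sub>0 + h) * b 0 (x\<^sub>0 + h) - 2 * (a 0 x\<^sub>0 * b 0 x\<^sub>0)
        + a 0 (x\<^sub>0 - h) * b 0 (x\<^sub>0 - h)) / h\<^sup>2"
    define Pcc where "Pcc = (c 0 (x\<^sub>0 + h) * c 0 (x\<^sub>0 + h) - 2 * (c 0 x\<^sub>0 * c 0 x\<^sub>0)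
        + c 0 (x\<^sub>0 - h) * c 0 (x\<^sub>0 - h)) / h\<^sup>2"
    \<comment> \<open>\<open>Qab\<close> and \<open>Qcc\<close> are the exact second derivatives at
      \<open>x\<^sub>0\<close> of \<open>a 0 * b 0\<close> and \<open>c 0 * c 0\<close>,
      approximated by \<open>Pab\<close> and \<open>Pcc\<close>.\<close>
    define Qab where "Qab = a 2 x\<^sub>0 * b 0 x\<^sub>0 + 2 * a 1 x\<^sub>0 * b 1 x\<^sub>0 + a 0 x\<^sub>0 * b 2 x\<^sub>0"
    define Qcc where "Qcc = c 2 x\<^sub>0 * c 0 x\<^sub>0 + 2 * c 1 x\<^sub>0 * c 1 x\<^sub>0 + c 0 x\<^sub>0 * c 2 x\<^sub>0"
    have scale: "\<bar>X / h\<^sup>2 - Y\<bar> \<le> Z * h\<^sup>2" if "\<bar>X - h\<^sup>2 * Y\<bar> \<le> Z * h ^ 4" for X Y Z :: real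
    proof -
      have "X / h\<^sup>2 - Y = (X - h\<^sup>2 * Y) / h\<^sup>2"
        using hk by (simp add: field_simps)
      then show ?thesis
        using that hk by (simp add: divide_le_eq power_add[symmetric] mult.assoc)
    qed
    have e1: "\<bar>Pab - Qab\<bar> \<le> 4 / 3 * (M * M) * h\<^sup>2"
      unfolding Pab_def Qab_def
      by (intro scale second_difference_mult da db Ma Mb) auto
    have e2: "\<bar>Pcc - Qcc\<bar> \<le> 4 / 3 * ((2 * M) * (2 * M)) * h\<^sup>2"
      unfolding Pcc_def Qcc_def
      by (intro scale second_difference_mult dc Mc) auto
    have e3: "\<bar>Qab / 2 - (m 1 * m 1 + m 0 * m 2)\<bar> \<le> M\<^sup>2 * k\<^sup>2"
    proof -
      have "Qab / 2 - (m 1 * m 1 + m 0 * m 2) =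
        ((a 0 x\<^sub>0 * b 2 x\<^sub>0 + b 0 x\<^sub>0 * a 2 x\<^sub>0) / 2 - m 0 * m 2)
        + ((a 1 x\<^sub>0 * b 1 x\<^sub>0 + b 1 x\<^sub>0 * a 1 x\<^sub>0) / 2 - m 1 * m 1)"
        unfolding Qab_def by (simp add: field_simps)
      also have "\<bar>\<dots>\<bar> \<le> M\<^sup>2 * k\<^sup>2 / 2 + M\<^sup>2 * k\<^sup>2 / 2"
        by (intro order_trans[OF abs_triangle_ineq] add_mono sym) auto
      finally show ?thesis by simp
    qed
    have e4: "\<bar>Qcc\<bar> \<le> 4 * (M\<^sup>2 * k\<^sup>2)"
    proof -
      have "Qcc = 2 * (c 0 x\<^sub>0 * c 2 x\<^sub>0) + 2 * (c 1 x\<^sub>0 * c 1 x\<^sub>0)"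
        by (simp add: Qcc_def)
      moreover have "\<bar>c 0 x\<^sub>0 * c 2 x\<^sub>0\<bar> \<le> M\<^sup>2 * k\<^sup>2" "\<bar>c 1 x\<^sub>0 * c 1 x\<^sub>0\<bar> \<le> M\<^sup>2 * k\<^sup>2"
        by (rule cc; simp)+
      ultimately show ?thesis by linarith
    qed
    define T where "T = w 1 0 (x\<^sub>0, t\<^sub>0 + k / 2)"
    have "\<bar>w 0 0 (x\<^sub>0, t\<^sub>0 + k / 2 + k / 2) - w 0 0 (x\<^sub>0, t\<^sub>0 + k / 2 - k / 2)
        - 2 * (k / 2) * T\<bar> \<le> M / 3 * \<bar>k / 2\<bar> ^ 3"
      unfolding T_def
      by (intro central_difference_bound[of "t\<^sub>0 + k / 2" "k / 2" "\<lambda>s. w 0 0 (x\<^sub>0, s)"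
            "\<lambda>s. w 1 0 (x\<^sub>0, s)" "\<lambda>s. w 2 0 (x\<^sub>0, s)" "\<lambda>s. w 3 0 (x\<^sub>0, s)"])
        (auto intro!: M wt[of _ _ 0, simplified] wt[of _ _ 1, simplified, folded numeral_2_eq_2]
          wt[of _ _ 2, simplified, folded numeral_3_eq_3] near_mid)
    then have "\<bar>c 0 x\<^sub>0 - k * T\<bar> \<le> M / 3 * (k / 2) ^ 3"
      using hk by (simp add: c_def a_def b_def ac_simps)
    \<comment> \<open>The constant 1 / 24 is rounded up to 1; one factor \<open>k\<close> is kept
      for the division by \<open>k\<close> that follows.\<close>
    also have "\<dots> \<le> M * k\<^sup>2 * k"
      using hk \<open>0 \<le> M\<close> by (simp add: field_simps power2_eq_square power3_eq_cube)
    finally have e5: "\<bar>c 0 x\<^sub>0 / k - T\<bar> \<le> M * k\<^sup>2"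
      using hk by (simp add: abs_le_iff field_simps)
    \<comment> \<open>The second x-derivative of \<open>c 0\<close> is itself a time difference,
      hence at most \<open>M * k\<close>; this absorbs the division by \<open>k\<close>.\<close>
    have "\<bar>c 0 (x\<^sub>0 + h) - 2 * c 0 x\<^sub>0 + c 0 (x\<^sub>0 - h)\<bar> \<le> M * k * h\<^sup>2"
      by (rule second_difference_bound[OF dc dc]) (auto intro!: Mck)
    then have e6: "\<bar>(c 0 (x\<^sub>0 + h) - 2 * c 0 x\<^sub>0 + c 0 (x\<^sub>0 - h)) / k\<bar> \<le> M * h\<^sup>2"
      using hk by (simp add: divide_le_eq algebra_simps)
    define E6 where "E6 = (c 0 (x\<^sub>0 + h) - 2 * c 0 x\<^sub>0 + c 0 (x\<^sub>0 - h)) / k"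
    have CS: "CS \<alpha> \<beta> h k x\<^sub>0 t\<^sub>0 (sample u h k x\<^sub>0 t\<^sub>0) = - (1 / 2) * Pab + \<beta> * Pcc + c 0 x\<^sub>0 / k + \<alpha> * E6"
      using hk by (subst CS_sample_eq) (auto simp: Pab_def Pcc_def E6_def c_def a_def b_def w_def)
    have heat: "heat u x\<^sub>0 (t\<^sub>0 + k / 2) = T - m 1 * m 1 - m 0 * m 2"
      using near_mid[of x\<^sub>0 "t\<^sub>0 + k / 2"] K(1)
      by (subst heat_eq_partials[OF assms(1) u])
        (auto simp: T_def m_def w_def numeral_2_eq_2)
    have combine: "\<bar>- (1 / 2) * p - q + s + t + v + z\<bar> \<le> P / 2 + Q + S + T' + V + Z"
      if "\<bar>p\<bar> \<le> P" "\<bar>q\<bar> \<le> Q" "\<bar>s\<bar> \<le> S" "\<bar>t\<bar> \<le> T'" "\<bar>v\<bar> \<le> V" "\<bar>z\<bar> \<le> Z"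
      for p q s t v z P Q S T' V Z :: real
      using that by linarith
    have e2': "\<bar>\<beta> * (Pcc - Qcc)\<bar> \<le> \<bar>\<beta>\<bar> * (4 / 3 * ((2 * M) * (2 * M)) * h\<^sup>2)"
      unfolding abs_mult by (intro mult_left_mono e2) auto
    have e4': "\<bar>\<beta> * Qcc\<bar> \<le> \<bar>\<beta>\<bar> * (4 * (M\<^sup>2 * k\<^sup>2))"
      unfolding abs_mult by (intro mult_left_mono e4) auto
    have e6': "\<bar>\<alpha> * E6\<bar> \<le> \<bar>\<alpha>\<bar> * (M * h\<^sup>2)"
      unfolding abs_mult E6_def by (intro mult_left_mono e6) auto
    \<comment> \<open>Inserting \<open>Qab / 2\<close> and \<open>\<beta> * Qcc\<close> separates
      the errors in x from those in t.\<close>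
    have "CS \<alpha> \<beta> h k x\<^sub>0 t\<^sub>0 (sample u h k x\<^sub>0 t\<^sub>0) - heat u x\<^sub>0 (t\<^sub>0 + k / 2) =
      - (1 / 2) * (Pab - Qab) - (Qab / 2 - (m 1 * m 1 + m 0 * m 2)) + \<beta> * (Pcc - Qcc) + \<beta> * Qcc
      + (c 0 x\<^sub>0 / k - T) + \<alpha> * E6"
      unfolding CS heat by (simp add: right_diff_distrib)
    also have "\<bar>\<dots>\<bar> \<le> 4 / 3 * (M * M) * h\<^sup>2 / 2 + M\<^sup>2 * k\<^sup>2
      + \<bar>\<beta>\<bar> * (4 / 3 * ((2 * M) * (2 * M)) * h\<^sup>2)
      + \<bar>\<beta>\<bar> * (4 * (M\<^sup>2 * k\<^sup>2)) + M * k\<^sup>2 + \<bar>\<alpha>\<bar> * (M * h\<^sup>2)"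
      by (rule combine[OF e1 e3 e2' e4' e5 e6'])
    also have "\<dots> = C1 * h\<^sup>2 + C2 * k\<^sup>2"
      by (simp add: C1_def C2_def power2_eq_square algebra_simps)
    also have "\<dots> \<le> C * h\<^sup>2 + C * k\<^sup>2"
      using \<open>0 \<le> C1\<close> \<open>0 \<le> C2\<close> by (intro add_mono mult_right_mono) (auto simp: C_def)
    finally show "\<bar>CS \<alpha> \<beta> h k x\<^sub>0 t\<^sub>0 (sample u h k x\<^sub>0 t\<^sub>0) - heat u x\<^sub>0 (t\<^sub>0 + k / 2)\<bar>
        \<le> C * (h\<^sup>2 + k\<^sup>2)"
      by (simp add: algebra_simps)
  qed
qed

text \<open>The error is distributed in the proportion \<open>h\<^sup>2 : k\<^sup>2\<close>.\<close>
lemma split_bigo_sum_of_squares: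
  fixes E :: "real \<Rightarrow> real \<Rightarrow> real"
  assumes "0 < r"
    and E: "\<And>h k. 0 < h \<Longrightarrow> h < r \<Longrightarrow> 0 < k \<Longrightarrow> k < r \<Longrightarrow> \<bar>E h k\<bar> \<le> C * (h\<^sup>2 + k\<^sup>2)"
  shows "\<exists>R\<^sub>x R\<^sub>t :: real \<times> real \<Rightarrow> real.
    R\<^sub>x \<in> O[at_right 0 \<times>\<^sub>F at_right 0](\<lambda>(h, k). h\<^sup>2) \<and>
    R\<^sub>t \<in> O[at_right 0 \<times>\<^sub>F at_right 0](\<lambda>(h, k). k\<^sup>2) \<and>
    (\<forall>h>0. \<forall>k>0. E h k = R\<^sub>x (h, k) + R\<^sub>t (h, k))"
proof -
  define q where "q h k = E h k / (h\<^sup>2 + k\<^sup>2)" for h k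
  have pos: "0 < h\<^sup>2 + k\<^sup>2" if "0 < h" for h k :: real
    using that by (simp add: add_pos_nonneg)
  have small: "\<forall>\<^sub>F h in at_right 0. 0 < h \<and> h < r"
    using assms(1) by (auto simp: eventually_at_right_field)
  have ev: "\<forall>\<^sub>F p in at_right 0 \<times>\<^sub>F at_right 0. \<bar>q (fst p) (snd p)\<bar> \<le> C"
    using eventually_prodI[OF small small]
    by eventually_elim (use E pos in \<open>auto simp: q_def divide_le_eq abs_of_pos\<close>)
  have "(\<lambda>p. q (fst p) (snd p) * (fst p)\<^sup>2) \<in> O[at_right 0 \<times>\<^sub>F at_right 0](\<lambda>(h, k). h\<^sup>2)"
    using ev by (intro bigoI[of _ C], eventually_elim)
      (auto simp: abs_mult case_prod_unfold intro: mult_right_mono)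
  moreover have "(\<lambda>p. q (fst p) (snd p) * (snd p)\<^sup>2) \<in> O[at_right 0 \<times>\<^sub>F at_right 0](\<lambda>(h, k). k\<^sup>2)"
    using ev by (intro bigoI[of _ C], eventually_elim)
      (auto simp: abs_mult case_prod_unfold intro: mult_right_mono)
  \<comment> \<open>The splitting is exact for every \<open>h > 0\<close>, even where
    \<open>E\<close> is not controlled, since the O-conditions concern only small stepsizes.\<close>
  moreover have "E h k = q h k * h\<^sup>2 + q h k * k\<^sup>2" if "0 < h" for h k
    using that by (simp add: q_def add_divide_distrib[symmetric] distrib_left[symmetric])
  ultimately show ?thesis
    by (intro exI conjI) auto
qed

section \<open>Conservation laws\<close>

text \<open>One common set of three space and two time indices contains every shift that
  occurs.\<close>

lemma finite_stencil_CS: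
  "finite_stencil (CS \<alpha> \<beta> \<Delta>x \<Delta>t)"
  "finite_stencil (\<lambda>x t u. 1)"
  "finite_stencil (xval \<Delta>x 0)"
  "finite_stencil (F1 \<beta> \<Delta>x \<Delta>t)"
  "finite_stencil (G1 \<alpha> \<Delta>x)"
  "finite_stencil (F2 \<beta> \<Delta>x \<Delta>t)"
  "finite_stencil (G2 \<alpha> \<Delta>x)"
  unfolding finite_stencil_def
  by (rule exI[of _ "{-1, 0, 1} \<times> {0, 1}"],
      simp add: CS_def F1_def G1_def F2_def G2_def flux_f_def mum_def xval_def
        Dm_def Dn_def Sm_def Sn_def uval_def)+

lemma CS_first_conservation_law:
  "preserves_conservation_law \<Delta>x \<Delta>t (CS \<alpha> \<beta> \<Delta>x \<Delta>t) (\<lambda>x t u. 1) (F1 \<beta> \<Delta>x \<Delta>t) (G1 \<alpha> \<Delta>x)"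
  by (simp add: preserves_conservation_law_def finite_stencil_CS) (simp add: CS_def)

text \<open>A discrete Leibniz rule: \<open>D\<^sub>m(\<mu>\<^sub>m(x\<^sub>-\<^sub>1) F\<^sub>1) = x\<^sub>0 D\<^sub>m F\<^sub>1 + \<mu>\<^sub>m F\<^sub>1\<close>, and
  \<open>\<mu>\<^sub>m F\<^sub>1 = D\<^sub>m \<mu>\<^sub>m f\<close>.\<close>
lemma CS_second_conservation_law:
  assumes "\<Delta>x \<noteq> 0"
  shows "preserves_conservation_law \<Delta>x \<Delta>t (CS \<alpha> \<beta> \<Delta>x \<Delta>t)
    (xval \<Delta>x 0) (F2 \<beta> \<Delta>x \<Delta>t) (G2 \<alpha> \<Delta>x)"
proof -
  have "xval \<Delta>x 0 x t u * CS \<alpha> \<beta> \<Delta>x \<Delta>t x t u =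
      Dm \<Delta>x (F2 \<beta> \<Delta>x \<Delta>t) x t u + Dn \<Delta>t (G2 \<alpha> \<Delta>x) x t u" for x t u
  proof -
    have "x * Dm \<Delta>x (F1 \<beta> \<Delta>x \<Delta>t) x t u = Dm \<Delta>x (F2 \<beta> \<Delta>x \<Delta>t) x t u"
      using assms
      by (simp add: F2_def F1_def mum_def xval_def Dm_def Sm_def field_simps)
    \<comment> \<open>The time shift leaves \<open>x\<close> fixed, so the factor passes through
      \<open>Dn\<close>.\<close>
    moreover have "x * Dn \<Delta>t (G1 \<alpha> \<Delta>x) x t u = Dn \<Delta>t (G2 \<alpha> \<Delta>x) x t u"
      by (simp add: G2_def xval_def Dn_def Sn_def right_diff_distrib)
    ultimately show ?thesis
      by (simp add: CS_def xval_def distrib_left)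
  qed
  then show ?thesis
    by (simp add: preserves_conservation_law_def finite_stencil_CS)
qed

theorem mainTheorem4:
  fixes \<alpha> \<beta> :: real
  shows "(\<forall>\<Delta>x>0. \<forall>\<Delta>t>0.
            preserves_conservation_law \<Delta>x \<Delta>t (CS \<alpha> \<beta> \<Delta>x \<Delta>t)
              (\<lambda>x t u. 1) (F1 \<beta> \<Delta>x \<Delta>t) (G1 \<alpha> \<Delta>x) \<and>
            preserves_conservation_law \<Delta>x \<Delta>t (CS \<alpha> \<beta> \<Delta>x \<Delta>t)
              (xval \<Delta>x 0) (F2 \<beta> \<Delta>x \<Delta>t) (G2 \<alpha> \<Delta>x)) \<and>
         (\<forall>(u :: real \<times> real \<Rightarrow> real) \<Omega> x\<^sub>0 t\<^sub>0.
            open \<Omega> \<longrightarrow> (x\<^sub>0, t\<^sub>0) \<in> \<Omega> \<longrightarrow> smooth_on \<Omega> u \<longrightarrow>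
            (\<exists>R\<^sub>x R\<^sub>t :: real \<times> real \<Rightarrow> real.
               R\<^sub>x \<in> O[at_right 0 \<times>\<^sub>F at_right 0](\<lambda>(\<Delta>x, \<Delta>t). \<Delta>x^2) \<and>
               R\<^sub>t \<in> O[at_right 0 \<times>\<^sub>F at_right 0](\<lambda>(\<Delta>x, \<Delta>t). \<Delta>t^2) \<and>
               (\<forall>\<Delta>x>0. \<forall>\<Delta>t>0.
                  CS \<alpha> \<beta> \<Delta>x \<Delta>t x\<^sub>0 t\<^sub>0 (sample u \<Delta>x \<Delta>t x\<^sub>0 t\<^sub>0) - heat u x\<^sub>0 (t\<^sub>0 + \<Delta>t / 2)
                    = R\<^sub>x (\<Delta>x, \<Delta>t) + R\<^sub>t (\<Delta>x, \<Delta>t))))"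
proof (intro conjI allI impI)
  fix \<Delta>x \<Delta>t :: real
  assume "\<Delta>x > 0"
  then show "preserves_conservation_law \<Delta>x \<Delta>t (CS \<alpha> \<beta> \<Delta>x \<Delta>t)
      (\<lambda>x t u. 1) (F1 \<beta> \<Delta>x \<Delta>t) (G1 \<alpha> \<Delta>x)"
    and "preserves_conservation_law \<Delta>x \<Delta>t (CS \<alpha> \<beta> \<Delta>x \<Delta>t)
      (xval \<Delta>x 0) (F2 \<beta> \<Delta>x \<Delta>t) (G2 \<alpha> \<Delta>x)"
    by (simp_all add: CS_first_conservation_law CS_second_conservation_law)
next
  fix u :: "real \<times> real \<Rightarrow> real" and \<Omega> x\<^sub>0 t\<^sub>0
  assume "open \<Omega>" "(x\<^sub>0, t\<^sub>0) \<in> \<Omega>" "smooth_on \<Omega> u"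
  then obtain r C where "0 < r" and
    "\<And>h k. 0 < h \<Longrightarrow> h < r \<Longrightarrow> 0 < k \<Longrightarrow> k < r \<Longrightarrow>
      \<bar>CS \<alpha> \<beta> h k x\<^sub>0 t\<^sub>0 (sample u h k x\<^sub>0 t\<^sub>0) - heat u x\<^sub>0 (t\<^sub>0 + k / 2)\<bar> \<le> C * (h\<^sup>2 + k\<^sup>2)"
    using CS_error_bound[where \<alpha> = \<alpha> and \<beta> = \<beta>] by blast
  then show "\<exists>R\<^sub>x R\<^sub>t :: real \<times> real \<Rightarrow> real.
      R\<^sub>x \<in> O[at_right 0 \<times>\<^sub>F at_right 0](\<lambda>(\<Delta>x, \<Delta>t). \<Delta>x^2) \<and>
      R\<^sub>t \<in> O[at_right 0 \<times>\<^sub>F at_right 0](\<lambda>(\<Delta>x, \<Delta>t). \<Delta>t^2) \<and>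
      (\<forall>\<Delta>x>0. \<forall>\<Delta>t>0.
        CS \<alpha> \<beta> \<Delta>x \<Delta>t x\<^sub>0 t\<^sub>0 (sample u \<Delta>x \<Delta>t x\<^sub>0 t\<^sub>0) - heat u x\<^sub>0 (t\<^sub>0 + \<Delta>t / 2)
          = R\<^sub>x (\<Delta>x, \<Delta>t) + R\<^sub>t (\<Delta>x, \<Delta>t))"
    by (rule split_bigo_sum_of_squares)
qed

end
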